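(* Let $G$ be a topological gyrogroup with an $\omega^{\omega}$-base $\{U_{\alpha}:\alpha\in\mathbb{N}^{\mathbb{N}}\}$. If $G$ is a sequential space, then $G$ has the strong Pytkeev property.
   Context: $\mathbb{N}$ is the set of positive integers. All topological spaces are assumed Hausdorff. A gyrogroup is a set $G$ with a binary operation $\oplus$ such that: (G1) there is a unique $0\in G$ with $0\oplus a=a=a\oplus 0$ for all $a$; (G2) for each $x$ there is a unique $\ominus x\in G$ with $\ominus x\oplus x=0=x\oplus(\ominus x)$; (G3) for all $x,y\in G$ there is an automorphism $\mathrm{gyr}[x,y]$ of $(G,\oplus)$ with $x\oplus(y\oplus z)=(x\oplus y)\oplus\mathrm{gyr}[x,y](z)$ for all $z\in G$; (G4) $\mathrm{gyr}[x\oplus y,y]=\mathrm{gyr}[x,y]$ for all $x,y\in G$. A topological gyrogroup is a gyrogroup with a topology for which $\oplus:G\times G\to G$ is jointly continuous and $x\mapsto\ominus x$ is continuous. $\mathbb{N}^{\mathbb{N}}$ carries the pointwise partial order: $\alpha\le\beta$ iff $\alpha_i\le\beta_i$ for all $i$. An $\omega^{\omega}$-base of a topological gyrogroup $G$ is a family $\{U_\alpha:\alpha\in\mathbb{N}^{\mathbb{N}}\}$ of neighborhoods of $0$ that is a base of neighborhoods at $0$ and satisfies $U_\beta\subset U_\alpha$ whenever $\alpha\le\beta$. A space is sequential if every sequentially open subset is open. $G$ has the strong Pytkeev property if there is a sequence $\{D_n\}_{n\in\mathbb{N}}$ of subsets of $G$ such that for each neighborhood $U$ of $0$ and each $A\subset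 G$ with $0\in\overline{A}\setminus A$ there is $n\in\mathbb{N}$ such that $D_n\subset U$ and $D_n\cap A$ is infinite. *)

theory Defs
  imports "HOL-Analysis.Elementary_Topology"
begin

locale gyrogroup =
  fixes oplus :: "'a \<Rightarrow> 'a \<Rightarrow> 'a" (infixl \<open>\<oplus>\<close> 65)
    and zero :: "'a" (\<open>\<zero>\<close>)
    and ominus :: "'a \<Rightarrow> 'a" (\<open>\<ominus> _\<close> [81] 80)
    and gyr :: "'a \<Rightarrow> 'a \<Rightarrow> 'a \<Rightarrow> 'a"
  assumes zero_left: "\<zero> \<oplus> a = a"
    and zero_right: "a \<oplus> \<zero> = a"
    and zero_unique: "(\<And>a. e \<oplus> a = a \<and> a \<oplus> e = a) \<Longrightarrow> e = \<zero>"
    and ominus_left: "(\<ominus> x) \<oplus> x = \<zero>"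
    and ominus_right: "x \<oplus> (\<ominus> x) = \<zero>"
    and ominus_unique: "y \<oplus> x = \<zero> \<Longrightarrow> x \<oplus> y = \<zero> \<Longrightarrow> y = \<ominus> x"
    and gyr_bij: "bij (gyr x y)"
    and gyr_hom: "gyr x y (u \<oplus> v) = gyr x y u \<oplus> gyr x y v"
    and gyr_assoc: "x \<oplus> (y \<oplus> z) = (x \<oplus> y) \<oplus> gyr x y z"
    and gyr_loop: "gyr (x \<oplus> y) y = gyr x y"

text \<open>Spaces are Hausdorff by convention, hence the sort \<open>t2_space\<close>.\<close>

locale topological_gyrogroup = gyrogroup oplus zero ominus gyr
  for oplus :: "'a::t2_space \<Rightarrow> 'a \<Rightarrow> 'a" (infixl \<open>\<oplus>\<close> 65)
    and zero :: "'a" (\<open>\<zero>\<close>)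
    and ominus :: "'a \<Rightarrow> 'a" (\<open>\<ominus> _\<close> [81] 80)
    and gyr :: "'a \<Rightarrow> 'a \<Rightarrow> 'a \<Rightarrow> 'a" +
  assumes continuous_oplus: "continuous_on UNIV (\<lambda>(x, y). x \<oplus> y)"
    and continuous_ominus: "continuous_on UNIV ominus"

text \<open>Neighborhoods need not be open.\<close>

definition nbhd :: "'a::topological_space \<Rightarrow> 'a set \<Rightarrow> bool" where
  "nbhd x U \<longleftrightarrow> (\<exists>V. open V \<and> x \<in> V \<and> V \<subseteq> U)"

text \<open>
  The index set is all of \<open>nat \<Rightarrow> nat\<close>; shifting indices and values by one
  is an order isomorphism onto the sequences of positive integers indexed by the positive
  integers. The order on \<open>nat \<Rightarrow> nat\<close> is the pointwise one.
\<close>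

definition omega_omega_base :: "'a::topological_space \<Rightarrow> ((nat \<Rightarrow> nat) \<Rightarrow> 'a set) \<Rightarrow> bool" where
  "omega_omega_base x U \<longleftrightarrow>
     (\<forall>\<alpha>. nbhd x (U \<alpha>)) \<and>
     (\<forall>W. nbhd x W \<longrightarrow> (\<exists>\<alpha>. U \<alpha> \<subseteq> W)) \<and>
     (\<forall>\<alpha> \<beta>. \<alpha> \<le> \<beta> \<longrightarrow> U \<beta> \<subseteq> U \<alpha>)"

definition sequentially_open :: "'a::topological_space set \<Rightarrow> bool" where
  "sequentially_open S \<longleftrightarrow>
     (\<forall>f l. f \<longlonglongrightarrow> l \<and> l \<in> S \<longrightarrow> (\<forall>\<^sub>F n in sequentially. f n \<in> S))"

definition sequential_space :: "'a::topological_space itself \<Rightarrow> bool" where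
  "sequential_space _ \<longleftrightarrow> (\<forall>S::'a set. sequentially_open S \<longrightarrow> open S)"

definition strong_Pytkeev :: "'a::topological_space \<Rightarrow> bool" where
  "strong_Pytkeev x \<longleftrightarrow>
     (\<exists>D :: nat \<Rightarrow> 'a set. \<forall>U A. nbhd x U \<and> x \<in> closure A - A \<longrightarrow>
        (\<exists>n. D n \<subseteq> U \<and> infinite (D n \<inter> A)))"

end

theory Submission imports Defs begin

text \<open>
  The theorem is an instance of a statement about one point of a space: in a sequential \<open>T\<^sub>1\<close> space, a point with an
  \<open>\<omega>\<^sup>\<omega>\<close>-base has the strong Pytkeev property.

  Passing to interiors, let the base \<open>V\<close> consist of open sets. For an index \<open>\<alpha>\<close> and a length
  \<open>k\<close> let \<open>cell V \<alpha> k\<close> be the intersection of all \<open>V \<beta>\<close> with \<open>\<beta>\<close> agreeing with \<open>\<alpha>\<close> below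
  \<open>k\<close>. A cell depends only on a finite sequence of numbers, so there are countably many of
  them; they are the required sets. They increase with \<open>k\<close> and lie in \<open>V \<alpha>\<close>.

  Everything rests on a diagonal argument (\<open>base_set_avoiding_finite_sets\<close>). A point outside
  \<open>cell V \<alpha> j\<close> is outside some \<open>V \<beta>\<close> with \<open>\<beta>\<close> agreeing with \<open>\<alpha>\<close> below \<open>j\<close>. If such a
  \<open>\<beta>\<close> is chosen for every \<open>j\<close>, each coordinate takes only finitely many values, so all these
  indices have a common upper bound \<open>\<gamma>\<close>, and \<open>V \<gamma>\<close> avoids all the given points at once. This
  has two consequences.

  \<^item> The union of the cells of \<open>\<alpha>\<close> is sequentially open (\<open>sequentially_open_Union_cell\<close>):
    for a sequence that converges to a point of the union and is infinitely often outside it, some \<open>V \<gamma>\<close> would be a neighborhood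
    of the limit missed by infinitely many terms. In a sequential space this union is therefore
    an open neighborhood of the point.
  \<^item> If a set \<open>A\<close> met every cell of \<open>\<alpha>\<close> in a finite set only, then some \<open>V \<gamma>\<close> would avoid
    all of the points of \<open>A\<close> in the union of the cells except finitely many. So the point
    would not be in the closure of \<open>A\<close> minus \<open>A\<close>.
\<close>

definition cell :: "((nat \<Rightarrow> nat) \<Rightarrow> 'a set) \<Rightarrow> (nat \<Rightarrow> nat) \<Rightarrow> nat \<Rightarrow> 'a set" where
  "cell V \<alpha> k = \<Inter> (V ` {\<beta>. \<forall>i<k. \<beta> i = \<alpha> i})"

lemma cell_subset: "(\<And>i. i < k \<Longrightarrow> \<beta> i = \<alpha> i) \<Longrightarrow> cell V \<alpha> k \<subseteq> V \<beta>"
  by (auto simp: cell_def)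

lemma cell_cong: "(\<And>i. i < k \<Longrightarrow> \<alpha> i = \<beta> i) \<Longrightarrow> cell V \<alpha> k = cell V \<beta> k"
  by (simp add: cell_def)

lemma upper_bound_of_stabilizing_indices:
  fixes \<beta> :: "nat \<Rightarrow> nat \<Rightarrow> nat"
  assumes "\<And>j i. i < k + j \<Longrightarrow> \<beta> j i = \<alpha> i"
  shows "\<exists>\<gamma>. (\<forall>j. \<beta> j \<le> \<gamma>) \<and> (\<forall>i<k. \<gamma> i = \<alpha> i)"
proof -
  \<comment> \<open>For \<open>j > i\<close> the value \<open>\<beta> j i\<close> is \<open>\<alpha> i\<close>, so this maximum is over all \<open>j\<close>.\<close>
  define \<gamma> where "\<gamma> i = Max (insert (\<alpha> i) ((\<lambda>j. \<beta> j i) ` {..i}))" for i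
  have "\<beta> j i \<le> \<gamma> i" for j i
  proof (cases "j \<le> i")
    case True
    then show ?thesis unfolding \<gamma>_def by (intro Max_ge) auto
  next
    case False
    then have "\<beta> j i = \<alpha> i" by (intro assms) simp
    then show ?thesis unfolding \<gamma>_def by (intro Max_ge) auto
  qed
  moreover have "\<gamma> i = \<alpha> i" if "i < k" for i
  proof -
    have "insert (\<alpha> i) ((\<lambda>j. \<beta> j i) ` {..i}) = {\<alpha> i}"
      using that assms by auto
    then show ?thesis by (simp only: \<gamma>_def Max_singleton)
  qed
  ultimately show ?thesis by (auto simp: le_fun_def)
qed

text \<open>
  The diagonal argument. For each \<open>j\<close> the finitely many points of \<open>F j\<close> are outside one common
  \<open>V (\<beta> j)\<close> with \<open>\<beta> j\<close> agreeing with \<open>\<alpha>\<close> below \<open>k + j\<close>, because the pointwise maximum of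
  finitely many such indices agrees with \<open>\<alpha>\<close> there too. The indices \<open>\<beta> j\<close> then have an upper
  bound. The offset \<open>k\<close> keeps this bound in agreement with \<open>\<alpha>\<close> below \<open>k\<close>.
\<close>

lemma base_set_avoiding_finite_sets:
  assumes antitone: "\<And>\<alpha> \<beta>. \<alpha> \<le> \<beta> \<Longrightarrow> V \<beta> \<subseteq> V \<alpha>"
    and fin: "\<And>j. finite (F j)"
    and outside: "\<And>j. F j \<inter> cell V \<alpha> (k + j) = {}"
  shows "\<exists>\<gamma>. (\<forall>i<k. \<gamma> i = \<alpha> i) \<and> (\<forall>j. F j \<inter> V \<gamma> = {})"
proof -
  have one: "\<exists>\<beta>. (\<forall>i<m. \<beta> i = \<alpha> i) \<and> S \<inter> V \<beta> = {}"
    if "finite S" "S \<inter> cell V \<alpha> m = {}" for S m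
    using that
  proof (induction S)
    case empty
    show ?case by auto
  next
    case (insert s S)
    then obtain \<beta> where \<beta>: "\<forall>i<m. \<beta> i = \<alpha> i" "S \<inter> V \<beta> = {}" by auto
    from insert.prems obtain \<beta>' where \<beta>': "\<forall>i<m. \<beta>' i = \<alpha> i" "s \<notin> V \<beta>'"
      by (auto simp: cell_def)
    let ?\<delta> = "\<lambda>i. max (\<beta> i) (\<beta>' i)"
    have "V ?\<delta> \<subseteq> V \<beta>" "V ?\<delta> \<subseteq> V \<beta>'" by (auto simp: le_fun_def intro!: antitone)
    with \<beta> \<beta>' have "(\<forall>i<m. ?\<delta> i = \<alpha> i) \<and> insert s S \<inter> V ?\<delta> = {}" by auto
    then show ?case by (rule exI[of _ ?\<delta>])
  qed
  obtain \<beta> where \<beta>: "\<And>j i. i < k + j \<Longrightarrow> \<beta> j i = \<alpha> i" "\<And>j. F j \<inter> V (\<beta> j) = {}"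
    using one[OF fin outside] by metis
  obtain \<gamma> where "\<forall>j. \<beta> j \<le> \<gamma>" "\<forall>i<k. \<gamma> i = \<alpha> i"
    using upper_bound_of_stabilizing_indices[of k \<beta> \<alpha>, OF \<beta>(1)] by auto
  with \<beta>(2) antitone show ?thesis by blast
qed

text \<open>
  The limit \<open>l\<close> of a sequence may be any point of a cell, not only the base point. Since \<open>l\<close>
  lies in \<open>cell V \<alpha> k\<close>, the set \<open>V \<gamma>\<close> is an open neighborhood of \<open>l\<close> as soon as \<open>\<gamma>\<close> agrees
  with \<open>\<alpha>\<close> below \<open>k\<close>.
\<close>

lemma sequentially_open_Union_cell:
  fixes V :: "(nat \<Rightarrow> nat) \<Rightarrow> 'a::topological_space set"
  assumes antitone: "\<And>\<alpha> \<beta>. \<alpha> \<le> \<beta> \<Longrightarrow> V \<beta> \<subseteq> V \<alpha>"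
    and op: "\<And>\<beta>. open (V \<beta>)"
  shows "sequentially_open (\<Union>k. cell V \<alpha> k)"
  unfolding sequentially_open_def
proof (intro allI impI, elim conjE, rule ccontr)
  fix f :: "nat \<Rightarrow> 'a" and l
  assume lim: "f \<longlonglongrightarrow> l" and "l \<in> (\<Union>k. cell V \<alpha> k)"
    and leaves: "\<not> (\<forall>\<^sub>F n in sequentially. f n \<in> (\<Union>k. cell V \<alpha> k))"
  then obtain k where k: "l \<in> cell V \<alpha> k" by auto
  have "\<exists>n\<ge>j. f n \<notin> cell V \<alpha> (k + j)" for j
    using leaves unfolding eventually_sequentially by blast
  then obtain n where n: "\<And>j. n j \<ge> j" "\<And>j. f (n j) \<notin> cell V \<alpha> (k + j)" by metis
  have "\<exists>\<gamma>. (\<forall>i<k. \<gamma> i = \<alpha> i) \<and> (\<forall>j. {f (n j)} \<inter> V \<gamma> = {})"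
    using n(2) by (intro base_set_avoiding_finite_sets antitone) auto
  then obtain \<gamma> where \<gamma>: "\<forall>i<k. \<gamma> i = \<alpha> i" "\<And>j. f (n j) \<notin> V \<gamma>" by auto
  have "l \<in> V \<gamma>" using k \<gamma>(1) cell_subset[of k \<gamma> \<alpha> V] by auto
  with lim op have "\<forall>\<^sub>F n in sequentially. f n \<in> V \<gamma>" by (rule topological_tendstoD)
  then show False using n(1) \<gamma>(2) unfolding eventually_sequentially by blast
qed

text \<open>
  If all the traces of \<open>A\<close> on cells were finite, the diagonal argument would apply to the
  differences of consecutive traces and leave only the finitely many points of
  \<open>A \<inter> cell V \<alpha> 0\<close>, which can be removed from a neighborhood of \<open>x\<close>.
\<close>

lemma infinite_trace_on_cell:
  fixes V :: "(nat \<Rightarrow> nat) \<Rightarrow> 'a::t1_space set"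
  assumes antitone: "\<And>\<alpha> \<beta>. \<alpha> \<le> \<beta> \<Longrightarrow> V \<beta> \<subseteq> V \<alpha>"
    and op: "\<And>\<beta>. open (V \<beta>)"
    and mem: "\<And>\<beta>. x \<in> V \<beta>"
    and op_cells: "open (\<Union>k. cell V \<alpha> k)"
    and x: "x \<in> closure A - A"
  shows "\<exists>k. infinite (cell V \<alpha> k \<inter> A)"
proof (rule ccontr)
  assume "\<not> ?thesis"
  then have fin: "finite (cell V \<alpha> k \<inter> A)" for k by blast
  define F where "F j = (cell V \<alpha> (Suc j) - cell V \<alpha> j) \<inter> A" for j
  have "finite (F j)" for j
    using fin[of "Suc j"] by (rule rev_finite_subset) (auto simp: F_def)
  then have "\<exists>\<gamma>. (\<forall>i<0. \<gamma> i = \<alpha> i) \<and> (\<forall>j. F j \<inter> V \<gamma> = {})"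
    by (intro base_set_avoiding_finite_sets antitone) (auto simp: F_def)
  then obtain \<gamma> where \<gamma>: "\<And>j. F j \<inter> V \<gamma> = {}" by auto
  have trace: "cell V \<alpha> k \<inter> A \<inter> V \<gamma> \<subseteq> cell V \<alpha> 0" for k
  proof (induction k)
    case (Suc k)
    then show ?case using \<gamma>[of k] by (auto simp: F_def)
  qed auto
  let ?W = "V \<gamma> \<inter> (\<Union>k. cell V \<alpha> k) - cell V \<alpha> 0 \<inter> A"
  have "open ?W" by (intro open_Diff open_Int op op_cells finite_imp_closed fin)
  moreover have "x \<in> ?W" using x mem by (auto simp: cell_def)
  moreover have "A \<inter> ?W = {}" using trace by blast
  ultimately show False using x closure_iff_nhds_not_empty by blast
qed

theorem strong_Pytkeev_if_sequential_omega_omega_base: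
  fixes U :: "(nat \<Rightarrow> nat) \<Rightarrow> 'a::t1_space set"
  assumes base: "omega_omega_base x U" and seq: "sequential_space TYPE('a)"
  shows "strong_Pytkeev x"
proof -
  define V where "V \<beta> = interior (U \<beta>)" for \<beta>
  have antitone: "V \<beta> \<subseteq> V \<alpha>" if "\<alpha> \<le> \<beta>" for \<alpha> \<beta>
    unfolding V_def using base that by (intro interior_mono) (simp add: omega_omega_base_def)
  have op: "open (V \<beta>)" for \<beta> by (simp add: V_def)
  have mem: "x \<in> V \<beta>" for \<beta>
  proof -
    have "nbhd x (U \<beta>)" using base by (simp add: omega_omega_base_def)
    then show ?thesis unfolding V_def nbhd_def by (blast intro: interiorI)
  qed
  \<comment> \<open>A finite sequence \<open>s\<close> is extended by zeros; the cell depends on \<open>s\<close> only.\<close>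
  define cell_of where
    "cell_of s = cell V (\<lambda>i. if i < length s then s ! i else 0) (length s)" for s
  have cell_of: "cell_of (map \<alpha> [0..<k]) = cell V \<alpha> k" for \<alpha> k
    unfolding cell_of_def length_map length_upt diff_zero by (rule cell_cong) simp
  define D where "D n = cell_of (from_nat n)" for n
  have "\<exists>n. D n \<subseteq> W \<and> infinite (D n \<inter> A)" if W: "nbhd x W" and A: "x \<in> closure A - A" for W A
  proof -
    obtain \<alpha> where \<alpha>: "U \<alpha> \<subseteq> W" using base W by (auto simp: omega_omega_base_def)
    have "open (\<Union>k. cell V \<alpha> k)"
      using seq sequentially_open_Union_cell[of V, OF antitone op]
      by (simp add: sequential_space_def)
    then have "\<exists>k. infinite (cell V \<alpha> k \<inter> A)"
      using A by (intro infinite_trace_on_cell[where x = x] antitone op mem)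
    then obtain k where k: "infinite (cell V \<alpha> k \<inter> A)" ..
    have "cell V \<alpha> k \<subseteq> V \<alpha>" by (rule cell_subset) simp
    also have "\<dots> \<subseteq> W" using \<alpha> interior_subset unfolding V_def by blast
    finally have "cell V \<alpha> k \<subseteq> W" .
    moreover have "D (to_nat (map \<alpha> [0..<k])) = cell V \<alpha> k" by (simp add: D_def cell_of)
    ultimately show ?thesis using k by metis
  qed
  then show ?thesis unfolding strong_Pytkeev_def by blast
qed

theorem theorem3p5:
  fixes oplus :: "'a::t2_space \<Rightarrow> 'a \<Rightarrow> 'a"
    and zero :: 'a
    and ominus :: "'a \<Rightarrow> 'a"
    and gyr :: "'a \<Rightarrow> 'a \<Rightarrow> 'a \<Rightarrow> 'a"
    and U :: "(nat \<Rightarrow> nat) \<Rightarrow> 'a set"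
  assumes "topological_gyrogroup oplus zero ominus gyr"
    and "omega_omega_base zero U"
    and "sequential_space TYPE('a)"
  shows "strong_Pytkeev zero"
  using assms(2,3) by (rule strong_Pytkeev_if_sequential_omega_omega_base)

end
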